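(* Let $G$ be a $2$-regular graph and let $H$ be a graph with $n=|V(H)|$ vertices. Then \[\chi_G(H)+\chi_G(\overline{H})\leq \left\lceil \frac{n}{2}\right\rceil+1,\] and this bound is sharp, i.e., there exist such graphs $H,G$ for which equality holds.
   Context: All graphs are finite and simple. A copy of $G$ in $H$ is a subgraph of $H$ isomorphic to $G$. A $G$-free $k$-coloring of $H$ is a map $\pi:V(H)\to\{1,\dots,k\}$ such that each induced subgraph $H[\pi^{-1}(i)]$ contains no copy of $G$; $\chi_G(H)$ is the least $k$ for which such a coloring exists. $\overline{H}$ is the complement of $H$. *)

theory Defs
  imports Complex_Main "HOL-Library.FuncSet" "Graph_Theory.Digraph_Isomorphism"
begin

text \<open>
  A finite simple graph is an \<^locale>\<open>pair_graph\<close>: each undirected edge $uv$ is represented by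
  the two arcs $(u,v)$ and $(v,u)$, so the degree of a vertex is its out-degree.
  The null graph is a \<^locale>\<open>pair_graph\<close>.
\<close>

definition regular_graph :: "nat \<Rightarrow> 'a pair_pre_digraph \<Rightarrow> bool" where
  "regular_graph d G \<longleftrightarrow> pair_graph G \<and> (\<forall>v\<in>pverts G. out_degree G v = d)"

definition graph_complement :: "'a pair_pre_digraph \<Rightarrow> 'a pair_pre_digraph" where
  "graph_complement H =
    \<lparr> pverts = pverts H,
      parcs = {(u, v). u \<in> pverts H \<and> v \<in> pverts H \<and> u \<noteq> v \<and> (u, v) \<notin> parcs H} \<rparr>"

text \<open>
  If \<open>G\<close> is symmetric and loop-free then so is every \<open>K\<close> isomorphic to it; hence for graphs it
  does not matter that \<open>K\<close> ranges over all subdigraphs of \<open>H\<close>.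
\<close>

definition contains_copy :: "('a, 'b) pre_digraph \<Rightarrow> ('c, 'd) pre_digraph \<Rightarrow> bool" where
  "contains_copy G H \<longleftrightarrow> (\<exists>K. subgraph K H \<and> digraph_iso G K)"

definition free_coloring ::
  "'a pair_pre_digraph \<Rightarrow> nat \<Rightarrow> 'b pair_pre_digraph \<Rightarrow> ('b \<Rightarrow> nat) \<Rightarrow> bool" where
  "free_coloring G k H \<pi> \<longleftrightarrow>
    \<pi> \<in> pverts H \<rightarrow> {1..k} \<and>
    (\<forall>i\<in>{1..k}. \<not> contains_copy (with_proj G) (with_proj H \<restriction> {v \<in> pverts H. \<pi> v = i}))"

text \<open>
  If \<open>G\<close> has at least two vertices then giving all vertices of a finite \<open>H\<close> distinct colours is
  a \<open>G\<close>-free coloring, so the minimum is attained. A nonempty \<open>H\<close> has no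
  \<open>G\<close>-free coloring when \<open>G\<close> is the null graph, and \<open>LEAST\<close> is then unspecified.
\<close>

definition free_chromatic_number ::
  "'a pair_pre_digraph \<Rightarrow> 'b pair_pre_digraph \<Rightarrow> nat" (\<open>\<chi>\<^bsub>_\<^esub>\<close>) where
  "\<chi>\<^bsub>G\<^esub> H = (LEAST k. \<exists>\<pi>. free_coloring G k H \<pi>)"

lemma pair_graph_graph_complement:
  assumes "pair_graph H"
  shows "pair_graph (graph_complement H)"
proof -
  interpret pair_graph H by fact
  have sym: "(v, u) \<in> parcs H \<longleftrightarrow> (u, v) \<in> parcs H" for u v
    using pair_sym_arcs by (auto simp: symmetric_def sym_def)
  have "finite (parcs (graph_complement H))"
    by (rule finite_subset[of _ "pverts H \<times> pverts H"])
      (auto simp: graph_complement_def pair_finite_verts)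
  then show ?thesis
    by unfold_locales
      (auto simp: graph_complement_def pair_finite_verts symmetric_def sym_def sym)
qed

end

theory Submission
  imports Defs
begin

text \<open>
  A copy of a 2-regular graph is a nonempty vertex set spanning minimum degree at least two, so a
  1-degenerate colour class contains none. Greedy colouring splits a \<open>d\<close>-degenerate graph into
  \<open>d div 2 + 1\<close> classes that are 1-degenerate. Finally, let \<open>H\<close> and its complement have
  degeneracies \<open>d\<close> and \<open>e\<close>, witnessed by vertex sets \<open>S\<close> and \<open>T\<close> of minimum degree \<open>d\<close> and \<open>e\<close>.
  If \<open>S\<close> and \<open>T\<close> share a vertex, its degrees in \<open>H\<close> and in the complement add up to \<open>n - 1\<close>;
  otherwise \<open>n \<ge> card S + card T \<ge> (d + 1) + (e + 1)\<close>. Either way \<open>d + e \<le> n - 1\<close>.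
\<close>

section \<open>Degeneracy and greedy colouring\<close>

text \<open>Stated for a bare relation and a vertex set, so that colour classes and complements are
  treated alike, without forming induced subgraphs.\<close>

definition degenerate :: "nat \<Rightarrow> 'a rel \<Rightarrow> 'a set \<Rightarrow> bool" where
  "degenerate d E V \<longleftrightarrow> (\<forall>S\<subseteq>V. S \<noteq> {} \<longrightarrow> (\<exists>v\<in>S. card (E `` {v} \<inter> S) \<le> d))"

lemma degenerate_subset: "degenerate d E V \<Longrightarrow> W \<subseteq> V \<Longrightarrow> degenerate d E W"
  unfolding degenerate_def by blast

text \<open>In a set containing \<open>v\<close>, the vertex \<open>v\<close> itself has small
  degree; any other nonempty set already lies in \<open>V\<close>. Irreflexivity keeps
  \<open>v\<close> out of its own neighbourhood, so counting inside \<open>V\<close>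
  suffices.\<close>

lemma degenerate_insert:
  assumes fin: "finite V" and irr: "irrefl E"
    and V: "degenerate d E V" and v: "card (E `` {v} \<inter> V) \<le> d"
  shows "degenerate d E (insert v V)"
  unfolding degenerate_def
proof (intro allI impI)
  fix S assume S: "S \<subseteq> insert v V" "S \<noteq> {}"
  show "\<exists>u\<in>S. card (E `` {u} \<inter> S) \<le> d"
  proof (cases "v \<in> S")
    case True
    have "E `` {v} \<inter> S \<subseteq> E `` {v} \<inter> V"
      using S irr by (auto simp: irrefl_def)
    then have "card (E `` {v} \<inter> S) \<le> card (E `` {v} \<inter> V)"
      using fin by (intro card_mono) auto
    with v True show ?thesis by (meson order_trans)
  next
    case False
    with S V show ?thesis unfolding degenerate_def by blast
  qed
qed

text \<open>Induction on the number of vertices: remove a vertex \<open>v\<close> of degree at most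
  \<open>d\<close>, colour the rest, and put \<open>v\<close> into a class where it has at most one
  neighbour. By \<open>degenerate_insert\<close> that class stays 1-degenerate.\<close>

lemma degenerate_partition:
  assumes "finite V" "irrefl E" "degenerate d E V"
  shows "\<exists>\<pi> \<in> V \<rightarrow> {1..d div 2 + 1}. \<forall>i. degenerate 1 E {v \<in> V. \<pi> v = i}"
  using assms(1,3)
proof (induction "card V" arbitrary: V)
  case 0
  then show ?case by (auto simp: degenerate_def)
next
  case (Suc m)
  let ?k = "d div 2 + 1"
  from Suc have "V \<noteq> {}" by auto
  then obtain v where v: "v \<in> V" "card (E `` {v} \<inter> V) \<le> d"
    using Suc.prems unfolding degenerate_def by blast
  let ?W = "V - {v}"
  have "m = card ?W" "finite ?W" "degenerate d E ?W"
    using Suc.hyps(2) Suc.prems v degenerate_subset[of d E V ?W] by auto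
  from Suc.hyps(1)[OF this] obtain \<pi> where
    \<pi>: "\<pi> \<in> ?W \<rightarrow> {1..?k}" "\<And>i. degenerate 1 E {u \<in> ?W. \<pi> u = i}"
    by blast
  define N where "N i = E `` {v} \<inter> {u \<in> ?W. \<pi> u = i}" for i
  \<comment> \<open>Pigeonhole: two neighbours of \<open>v\<close> in each of the
    \<open>d div 2 + 1\<close> disjoint classes would give \<open>2 * (d div 2 + 1) > d\<close>
    neighbours.\<close>
  have "\<exists>c\<in>{1..?k}. card (N c) \<le> 1"
  proof (rule ccontr)
    assume "\<not> ?thesis"
    then have "(\<Sum>c\<in>{1..?k}. 2) \<le> (\<Sum>c\<in>{1..?k}. card (N c))"
      by (intro sum_mono) force
    also have "\<dots> = card (\<Union>c\<in>{1..?k}. N c)"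
      using Suc.prems(1) by (intro card_UN_disjoint[symmetric]) (auto simp: N_def)
    also have "\<dots> \<le> card (E `` {v} \<inter> V)"
      using Suc.prems(1) by (intro card_mono) (auto simp: N_def)
    also have "\<dots> \<le> d" by (fact v(2))
    finally show False by simp
  qed
  then obtain c where c: "c \<in> {1..?k}" "card (N c) \<le> 1" by blast
  show ?case
  proof (intro bexI allI)
    show "\<pi>(v := c) \<in> V \<rightarrow> {1..?k}" using \<pi>(1) c(1) by auto
    fix i
    show "degenerate 1 E {u \<in> V. (\<pi>(v := c)) u = i}"
    proof (cases "i = c")
      case True
      have "degenerate 1 E (insert v {u \<in> ?W. \<pi> u = c})"
        using Suc.prems(1) assms(2) \<pi>(2) c(2) by (intro degenerate_insert) (auto simp: N_def)
      moreover have "{u \<in> V. (\<pi>(v := c)) u = i} = insert v {u \<in> ?W. \<pi> u = c}"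
        using True v(1) by auto
      ultimately show ?thesis by simp
    next
      case False
      then have "{u \<in> V. (\<pi>(v := c)) u = i} = {u \<in> ?W. \<pi> u = i}" by auto
      with \<pi>(2) show ?thesis by simp
    qed
  qed
qed

section \<open>Degeneracies of a graph and its complement\<close>

text \<open>A crude bound whose purpose is to show that \<open>LEAST\<close> is attained, both for
  the degeneracy and for the free chromatic number.\<close>

lemma degenerate_card:
  assumes "finite V"
  shows "degenerate (card V) E V"
  unfolding degenerate_def using assms
  by (metis Int_lower2 card_mono dual_order.trans ex_in_conv finite_subset)

text \<open>Take \<open>d\<close> least. If \<open>d > 0\<close>, then \<open>d - 1\<close> fails,
  and a set witnessing the failure has all degrees at least \<open>d\<close>; if
  \<open>d = 0\<close>, all of \<open>V\<close> serves.\<close>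

lemma obtain_degeneracy:
  assumes "finite V" "V \<noteq> {}"
  obtains d S where "degenerate d E V" "S \<subseteq> V" "S \<noteq> {}" "\<And>v. v \<in> S \<Longrightarrow> d \<le> card (E `` {v} \<inter> S)"
proof -
  define d where "d = (LEAST d. degenerate d E V)"
  have d: "degenerate d E V"
    unfolding d_def using degenerate_card[OF assms(1)] by (rule LeastI)
  have "\<exists>S\<subseteq>V. S \<noteq> {} \<and> (\<forall>v\<in>S. d \<le> card (E `` {v} \<inter> S))"
  proof (cases d)
    case 0
    with assms(2) show ?thesis by auto
  next
    case (Suc d')
    then have "\<not> degenerate d' E V"
      unfolding d_def using not_less_Least[of d' "\<lambda>d. degenerate d E V"] by simp
    with Suc show ?thesis unfolding degenerate_def by (auto simp: not_le Suc_le_eq)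
  qed
  with d that show ?thesis by blast
qed

lemma degeneracies_complementary:
  assumes fin: "finite V" and ne: "V \<noteq> {}" and irr: "irrefl E" "irrefl F" and disj: "E \<inter> F = {}"
  obtains d e where "degenerate d E V" "degenerate e F V" "d + e < card V"
proof -
  obtain d S where S: "degenerate d E V" "S \<subseteq> V" "S \<noteq> {}"
    "\<And>v. v \<in> S \<Longrightarrow> d \<le> card (E `` {v} \<inter> S)"
    using obtain_degeneracy[OF fin ne] by blast
  obtain e T where T: "degenerate e F V" "T \<subseteq> V" "T \<noteq> {}"
    "\<And>v. v \<in> T \<Longrightarrow> e \<le> card (F `` {v} \<inter> T)"
    using obtain_degeneracy[OF fin ne] by blast
  have fins: "finite S" "finite T" using S(2) T(2) fin finite_subset by blast+
  have "d + e < card V"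
  proof (cases "S \<inter> T = {}")
    case True
    from S(3) T(3) obtain s t where st: "s \<in> S" "t \<in> T" by blast
    \<comment> \<open>The neighbourhood misses \<open>s\<close> itself, whence
      \<open>d + 1 \<le> card S\<close>; likewise for \<open>t\<close> and \<open>T\<close>.\<close>
    have "card (E `` {s} \<inter> S) < card S"
      using st irr fins by (intro psubset_card_mono) (auto simp: irrefl_def)
    moreover have "card (F `` {t} \<inter> T) < card T"
      using st irr fins by (intro psubset_card_mono) (auto simp: irrefl_def)
    moreover have "card S + card T \<le> card V"
      using True S(2) T(2) fin fins
      by (metis Un_least card_Un_disjoint card_mono)
    ultimately show ?thesis using S(4)[OF st(1)] T(4)[OF st(2)] by linarith
  next
    case False
    then obtain v where v: "v \<in> S" "v \<in> T" by blast
    have "card (E `` {v} \<inter> S) + card (F `` {v} \<inter> T) = card ((E `` {v} \<inter> S) \<union> (F `` {v} \<inter> T))"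
      using fins disj by (intro card_Un_disjoint[symmetric]) auto
    \<comment> \<open>By irreflexivity \<open>v\<close> lies in neither neighbourhood, so their
      union is a proper subset of \<open>V\<close>.\<close>
    also have "\<dots> < card V"
      using v S(2) T(2) irr fin by (intro psubset_card_mono) (auto simp: irrefl_def)
    finally show ?thesis using S(4)[OF v(1)] T(4)[OF v(2)] by linarith
  qed
  with S(1) T(1) that show ?thesis by blast
qed

section \<open>Free colourings from degeneracy\<close>

lemma not_contains_copy_degenerate:
  assumes G: "regular_graph (Suc d) G" "pverts G \<noteq> {}"
    and X: "finite X" "degenerate d (parcs H) X"
  shows "\<not> contains_copy (with_proj G) (with_proj H \<restriction> X)"
proof
  assume "contains_copy (with_proj G) (with_proj H \<restriction> X)"
  then obtain f where
    sub: "subgraph (app_iso f (with_proj G)) (with_proj H \<restriction> X)" and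
    f: "pre_digraph.digraph_isomorphism (with_proj G) f"
    unfolding contains_copy_def digraph_iso_def by blast
  let ?K = "app_iso f (with_proj G)"
  interpret G: pair_graph G using G by (simp add: regular_graph_def)
  interpret K: wf_digraph ?K using sub by blast
  have K: "verts ?K \<subseteq> X" "arcs ?K \<subseteq> parcs H" "tail ?K = fst" "head ?K = snd"
    using sub by (auto simp: subgraph_def compatible_def induce_subgraph_def)
  have "verts ?K \<noteq> {}" using G(2) by simp
  then obtain v where v: "v \<in> verts ?K" "card (parcs H `` {v} \<inter> verts ?K) \<le> d"
    using X(2) K(1) unfolding degenerate_def by blast
  from v(1) obtain u where u: "u \<in> pverts G" "v = iso_verts f u" by auto
  have "out_degree ?K v = out_degree (with_proj G) u"
    unfolding u(2) by (rule G.out_degree_app_iso_eq[OF f]) (use u in simp)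
  also have "\<dots> = Suc d" using G(1) u(1) by (simp add: regular_graph_def)
  finally have "Suc d = card (out_arcs ?K v)" by (simp add: out_degree_def)
  \<comment> \<open>Out-degree counts arcs, degeneracy counts neighbours. They agree here because
    the copy inherits \<open>fst\<close> and \<open>snd\<close> as tail and head, so an arc leaving
    \<open>v\<close> is determined by its head.\<close>
  also have "\<dots> = card (snd ` out_arcs ?K v)"
  proof (rule card_image[symmetric], rule inj_onI)
    fix a b assume "a \<in> out_arcs ?K v" "b \<in> out_arcs ?K v" "snd a = snd b"
    then show "a = b" unfolding in_out_arcs_conv K(3) by (simp add: prod_eq_iff)
  qed
  also have "\<dots> \<le> card (parcs H `` {v} \<inter> verts ?K)"
  proof (rule card_mono)
    show "finite (parcs H `` {v} \<inter> verts ?K)" using K(1) X(1) finite_subset by blast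
    show "snd ` out_arcs ?K v \<subseteq> parcs H `` {v} \<inter> verts ?K"
    proof
      fix w assume "w \<in> snd ` out_arcs ?K v"
      then obtain a where a: "a \<in> arcs ?K" "tail ?K a = v" "w = snd a"
        unfolding image_iff Bex_def in_out_arcs_conv by blast
      have "a = (v, w)" using a(2,3) unfolding K(3) by (simp add: prod_eq_iff)
      then show "w \<in> parcs H `` {v} \<inter> verts ?K"
        using a(1) K(2) K.head_in_verts[OF a(1)] unfolding K(4) by auto
    qed
  qed
  finally show False using v(2) by simp
qed

lemma ex_free_coloring_degenerate:
  assumes G: "regular_graph 2 G" "pverts G \<noteq> {}"
    and H: "pair_graph H" "degenerate d (parcs H) (pverts H)"
  shows "\<exists>\<pi>. free_coloring G (d div 2 + 1) H \<pi>"
proof -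
  interpret H: pair_graph H by (fact H(1))
  have irr: "irrefl (parcs H)" using H.pair_no_loops by (fastforce simp: irrefl_def)
  obtain \<pi> where \<pi>: "\<pi> \<in> pverts H \<rightarrow> {1..d div 2 + 1}"
    "\<And>i. degenerate 1 (parcs H) {v \<in> pverts H. \<pi> v = i}"
    using degenerate_partition[OF H.pair_finite_verts irr H(2)] by blast
  have "\<not> contains_copy (with_proj G) (with_proj H \<restriction> {v \<in> pverts H. \<pi> v = i})" for i
    using G H.pair_finite_verts \<pi>(2)
    by (intro not_contains_copy_degenerate[of 1]) (simp_all add: numeral_2_eq_2)
  with \<pi>(1) show ?thesis unfolding free_coloring_def by blast
qed

lemma free_chromatic_number_le_degenerate:
  assumes "regular_graph 2 G" "pverts G \<noteq> {}" "pair_graph H" "degenerate d (parcs H) (pverts H)"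
  shows "\<chi>\<^bsub>G\<^esub> H \<le> d div 2 + 1"
  unfolding free_chromatic_number_def
  using ex_free_coloring_degenerate[OF assms] by (rule Least_le)

text \<open>By \<open>degenerate_card\<close> the greedy colouring applies to every
  \<open>H\<close>, so some number of colours is admissible and \<open>LEAST\<close> is
  attained.\<close>

lemma ex_free_coloring_free_chromatic_number:
  assumes "regular_graph 2 G" "pverts G \<noteq> {}" "pair_graph H"
  shows "\<exists>\<pi>. free_coloring G (\<chi>\<^bsub>G\<^esub> H) H \<pi>"
proof -
  interpret H: pair_graph H by (fact assms(3))
  show ?thesis
    using ex_free_coloring_degenerate[OF assms degenerate_card[OF H.pair_finite_verts]]
    unfolding free_chromatic_number_def by (rule LeastI)
qed

lemma free_chromatic_number_pos:
  assumes "regular_graph 2 G" "pverts G \<noteq> {}" "pair_graph H" "pverts H \<noteq> {}"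
  shows "\<chi>\<^bsub>G\<^esub> H \<ge> 1"
proof -
  obtain \<pi> where "\<pi> \<in> pverts H \<rightarrow> {1..\<chi>\<^bsub>G\<^esub> H}"
    using ex_free_coloring_free_chromatic_number[OF assms(1-3)]
    unfolding free_coloring_def by blast
  with assms(4) show ?thesis by fastforce
qed

text \<open>With one colour the only class is all of \<open>G\<close>, which is a copy of itself
  under the identity. This is the lower bound for the sharpness example.\<close>

lemma free_chromatic_number_self:
  assumes "regular_graph 2 G" "pverts G \<noteq> {}"
  shows "\<chi>\<^bsub>G\<^esub> G \<ge> 2"
proof (rule ccontr)
  assume less: "\<not> \<chi>\<^bsub>G\<^esub> G \<ge> 2"
  have G: "pair_graph G" using assms by (simp add: regular_graph_def)
  interpret G: pair_graph G by (fact G)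
  have one: "\<chi>\<^bsub>G\<^esub> G = 1"
    using less free_chromatic_number_pos[OF assms G assms(2)] by linarith
  obtain \<pi> where \<pi>: "\<pi> \<in> pverts G \<rightarrow> {Suc 0}"
    "\<not> contains_copy (with_proj G) (with_proj G \<restriction> {v \<in> pverts G. \<pi> v = Suc 0})"
    using ex_free_coloring_free_chromatic_number[OF assms G]
    unfolding free_coloring_def one by auto
  have "{v \<in> pverts G. \<pi> v = Suc 0} = pverts G" using \<pi>(1) by auto
  moreover have "with_proj G \<restriction> pverts G = with_proj G"
    using G.in_arcsD1 G.in_arcsD2
    by (auto simp: induce_subgraph_def with_proj_def)
  moreover have "contains_copy (with_proj G) (with_proj G)"
  proof -
    let ?f = "\<lparr>iso_verts = id, iso_arcs = id, iso_head = snd, iso_tail = fst\<rparr>"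
    have "G.digraph_isomorphism ?f"
      using G.wf_digraph_axioms by (simp add: G.digraph_isomorphism_def)
    moreover have "with_proj G = app_iso ?f (with_proj G)"
      by (simp add: app_iso_def with_proj_def)
    ultimately show ?thesis
      unfolding contains_copy_def digraph_iso_def using G.subgraph_refl by blast
  qed
  ultimately show False using \<pi>(2) by simp
qed

section \<open>The upper bound and its sharpness\<close>

lemma free_chromatic_number_Nordhaus_Gaddum:
  assumes G: "regular_graph 2 G" "pverts G \<noteq> {}" and H: "pair_graph H"
  shows "int (\<chi>\<^bsub>G\<^esub> H) + int (\<chi>\<^bsub>G\<^esub> (graph_complement H)) \<le> \<lceil>real (card (pverts H)) / 2\<rceil> + 1"
proof -
  let ?C = "graph_complement H"
  note C = pair_graph_graph_complement[OF H]
  interpret H: pair_graph H by (fact H)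
  have VC: "pverts ?C = pverts H" by (simp add: graph_complement_def)
  show ?thesis
  proof (cases "pverts H = {}")
    case True
    \<comment> \<open>The empty graph is treated apart, since \<open>d + e < card (pverts H)\<close>
      is impossible there. Zero colours suffice vacuously for it and its complement.\<close>
    have "\<chi>\<^bsub>G\<^esub> K = 0" if "pverts K = {}" for K :: "'b pair_pre_digraph"
      unfolding free_chromatic_number_def
      by (rule Least_eq_0, rule exI[of _ "\<lambda>_. 0"]) (simp add: free_coloring_def that)
    with True VC show ?thesis by simp
  next
    case False
    have "irrefl (parcs H)" using H.pair_no_loops by (fastforce simp: irrefl_def)
    moreover have "irrefl (parcs ?C)" "parcs H \<inter> parcs ?C = {}"
      by (auto simp: irrefl_def graph_complement_def)
    ultimately obtain d e where de: "degenerate d (parcs H) (pverts H)"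
      "degenerate e (parcs ?C) (pverts H)" "d + e < card (pverts H)"
      using degeneracies_complementary[OF H.pair_finite_verts False] by metis
    have "2 * \<chi>\<^bsub>G\<^esub> H \<le> d + 2"
      using free_chromatic_number_le_degenerate[OF G H de(1)] by simp
    moreover have "2 * \<chi>\<^bsub>G\<^esub> ?C \<le> e + 2"
      using free_chromatic_number_le_degenerate[OF G C, unfolded VC, OF de(2)] by simp
    ultimately have "2 * (\<chi>\<^bsub>G\<^esub> H + \<chi>\<^bsub>G\<^esub> ?C) \<le> card (pverts H) + 3"
      using de(3) by simp
    \<comment> \<open>The sum minus 2 is at most \<open>(n - 1) / 2\<close>, where \<open>n\<close>
      is the number of vertices. Being an integer strictly below \<open>n / 2\<close>, it is at most
      the ceiling of \<open>n / 2\<close> minus 1.\<close>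
    then have "real_of_int (int (\<chi>\<^bsub>G\<^esub> H) + int (\<chi>\<^bsub>G\<^esub> ?C) - 2) < real (card (pverts H)) / 2"
      by simp
    then show ?thesis by linarith
  qed
qed

theorem theorem7:
  shows "(\<forall>(G :: 'a pair_pre_digraph) (H :: 'b pair_pre_digraph) (n :: nat).
            regular_graph 2 G \<longrightarrow> pverts G \<noteq> {} \<longrightarrow> pair_graph H \<longrightarrow> n = card (pverts H) \<longrightarrow>
            int (\<chi>\<^bsub>G\<^esub> H) + int (\<chi>\<^bsub>G\<^esub> (graph_complement H)) \<le> \<lceil>real n / 2\<rceil> + 1)
       \<and> (\<exists>(G :: nat pair_pre_digraph) (H :: nat pair_pre_digraph) (n :: nat).
            regular_graph 2 G \<and> pverts G \<noteq> {} \<and> pair_graph H \<and> n = card (pverts H) \<and>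
            int (\<chi>\<^bsub>G\<^esub> H) + int (\<chi>\<^bsub>G\<^esub> (graph_complement H)) = \<lceil>real n / 2\<rceil> + 1)"
proof (intro conjI allI impI)
  fix G :: "'a pair_pre_digraph" and H :: "'b pair_pre_digraph" and n :: nat
  assume "regular_graph 2 G" "pverts G \<noteq> {}" "pair_graph H" "n = card (pverts H)"
  then show "int (\<chi>\<^bsub>G\<^esub> H) + int (\<chi>\<^bsub>G\<^esub> (graph_complement H)) \<le> \<lceil>real n / 2\<rceil> + 1"
    using free_chromatic_number_Nordhaus_Gaddum by blast
next
  \<comment> \<open>The triangle serves as both \<open>G\<close> and \<open>H\<close>: the lower
    bounds 2 for \<open>?K\<close> and 1 for its complement add up to 3, which is the upper bound
    for three vertices.\<close>
  let ?K = "\<lparr>pverts = {0, 1, 2},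
    parcs = {(0, 1), (1, 0), (0, 2), (2, 0), (1, 2), (2, 1)}\<rparr> :: nat pair_pre_digraph"
  have K: "pair_graph ?K"
    by unfold_locales (auto simp: symmetric_def sym_def)
  have "out_arcs (with_proj ?K) 0 = {(0, 1), (0, 2)}"
    "out_arcs (with_proj ?K) 1 = {(1, 0), (1, 2)}"
    "out_arcs (with_proj ?K) 2 = {(2, 0), (2, 1)}"
    by (auto simp: out_arcs_def)
  then have reg: "regular_graph 2 ?K"
    using K by (simp add: regular_graph_def out_degree_def)
  have ne: "pverts ?K \<noteq> {}" by simp
  have "\<chi>\<^bsub>?K\<^esub> ?K \<ge> 2" using free_chromatic_number_self[OF reg ne] .
  moreover have "\<chi>\<^bsub>?K\<^esub> (graph_complement ?K) \<ge> 1"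
    using free_chromatic_number_pos[OF reg ne pair_graph_graph_complement[OF K]]
    by (simp add: graph_complement_def)
  moreover have "card (pverts ?K) = 3" by simp
  moreover have "\<lceil>real 3 / 2\<rceil> + 1 = 3" by (simp add: ceiling_eq_iff)
  moreover note free_chromatic_number_Nordhaus_Gaddum[OF reg ne K]
  ultimately have "int (\<chi>\<^bsub>?K\<^esub> ?K) + int (\<chi>\<^bsub>?K\<^esub> (graph_complement ?K))
      = \<lceil>real (card (pverts ?K)) / 2\<rceil> + 1"
    by linarith
  with reg ne K show "\<exists>(G :: nat pair_pre_digraph) (H :: nat pair_pre_digraph) (n :: nat).
      regular_graph 2 G \<and> pverts G \<noteq> {} \<and> pair_graph H \<and> n = card (pverts H) \<and>
      int (\<chi>\<^bsub>G\<^esub> H) + int (\<chi>\<^bsub>G\<^esub> (graph_complement H)) = \<lceil>real n / 2\<rceil> + 1"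
    by blast
qed

end
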